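(* Let $N\ge 2$ be an integer and let $\mathcal{Q}_N=\{1^2,2^2,\dots,\lfloor\sqrt N\rfloor^2\}$. Let $T\ge 1$ and, for $i=1,\dots,T$, let $X_i=\{m_i j+r_i : 1\le j\le k_i\}\subseteq\{1,2,\dots,N\}$ be an arithmetic progression with positive integer difference $m_i$, integer $r_i$ and length $k_i\ge 1$, such that $\bigcup_{i=1}^T X_i\supseteq \mathcal{Q}_N$. Put $K:=\max\{\tau(m_i): i=1,2,\dots,T\}$. Then $$T\sum_{i=1}^T k_i\ \ge\ \frac{N}{4K\log N}.$$
   Context: $\tau(x)$ is the divisor function, i.e. the number of positive divisors of the positive integer $x$. $\log$ denotes the natural logarithm. *)

theory Defs
  imports Complex_Main
begin

text \<open>Meaningful for positive \<open>n\<close> only: the set of divisors of \<open>0\<close> is infinite, so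
  \<open>divisor_count 0 = 0\<close>.\<close>

definition divisor_count :: "nat \<Rightarrow> nat" where
  "divisor_count n = card {d. d dvd n}"

text \<open>Indices start at \<open>1\<close>, so the first term is \<open>m + r\<close>; the offset \<open>r\<close> may be negative.\<close>

definition arith_prog :: "nat \<Rightarrow> int \<Rightarrow> nat \<Rightarrow> int set" where
  "arith_prog m r k = {int m * int j + r | j. 1 \<le> j \<and> j \<le> k}"

definition squares_upto :: "nat \<Rightarrow> int set" where
  "squares_upto N = {n ^ 2 | n. 1 \<le> n \<and> n \<le> \<lfloor>sqrt (real N)\<rfloor>}"

end

theory Submission
  imports Defs "HOL-Analysis.Harmonic_Numbers"
begin

text \<open>
  Let \<open>S\<close> be the number of squares in a progression of difference \<open>m\<close> and length \<open>k\<close>.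
  Two such squares satisfy \<open>(x - y) * (x + y) = m * t\<close> with \<open>1 \<le> t \<le> k\<close>. Splitting \<open>m\<close>
  between the two factors, \<open>x - y = d * u\<close> and \<open>x + y = (m / d) * v\<close> with \<open>u * v = t\<close>, so the pair
  is determined by a divisor \<open>d\<close> of \<open>m\<close> and a point \<open>(u, v)\<close> below the hyperbola \<open>u * v = k\<close>.
  Hence \<open>S\<^sup>2 \<le> S + 2 \<tau>(m) k (1 + ln k) \<le> \<tau>(m) k (3 + 2 ln k)\<close>. Summing \<open>S\<close> over the progressions
  and applying the Cauchy--Schwarz inequality gives the claim as soon as \<open>\<lfloor>sqrt N\<rfloor> \<ge> 6\<close>; for smaller
  \<open>N\<close> the trivial bound \<open>S \<le> k\<close> suffices.
\<close>

section \<open>Lattice points below a hyperbola\<close>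

definition hyperbola_points :: "nat \<Rightarrow> (nat \<times> nat) set" where
  "hyperbola_points n = (SIGMA u:{1..n}. {1..n div u})"

lemma hyperbola_points_iff:
  "(u, v) \<in> hyperbola_points n \<longleftrightarrow> u \<ge> 1 \<and> v \<ge> 1 \<and> u * v \<le> n"
proof -
  have "u \<le> n" if "v \<ge> 1" "u * v \<le> n"
    using that by (metis mult.commute mult_le_mono1 nat_mult_1 le_trans)
  thus ?thesis
    by (auto simp: hyperbola_points_def less_eq_div_iff_mult_less_eq mult.commute)
qed

lemma finite_hyperbola_points: "finite (hyperbola_points n)"
  by (simp add: hyperbola_points_def)

lemma card_hyperbola_points_le:
  assumes "n \<ge> 1"
  shows "real (card (hyperbola_points n)) \<le> real n * (1 + ln (real n))"
proof -
  have "real (card (hyperbola_points n)) = (\<Sum>u=1..n. real (n div u))"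
    by (simp add: hyperbola_points_def)
  also have "\<dots> \<le> (\<Sum>u=1..n. real n * inverse (real u))"
    unfolding divide_inverse[symmetric] by (intro sum_mono of_nat_div_le_of_nat)
  also have "\<dots> = real n * harm n"
    by (simp add: harm_def sum_distrib_left)
  \<comment> \<open>The sequence \<open>harm n - ln n\<close> decreases and has value 1 at
    \<open>n = 1\<close>.\<close>
  also have "\<dots> \<le> real n * (1 + ln (real n))"
    using euler_mascheroni_sequence_decreasing[of 1 n] assms
    by (intro mult_left_mono) (auto simp: harm_expand)
  finally show ?thesis .
qed

section \<open>Square roots of the squares in a progression\<close>

definition square_roots :: "int set \<Rightarrow> nat set" where
  "square_roots X = {x. x \<ge> 1 \<and> (int x)\<^sup>2 \<in> X}"

lemma arith_prog_eq_image: "arith_prog m r k = (\<lambda>j. int m * int j + r) ` {1..k}"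
  by (auto simp: arith_prog_def)

lemma finite_arith_prog: "finite (arith_prog m r k)"
  by (simp add: arith_prog_eq_image)

lemma card_arith_prog_le: "card (arith_prog m r k) \<le> k"
  unfolding arith_prog_eq_image using card_image_le[of "{1..k}"] by simp

lemma card_arith_prog:
  assumes "m > 0"
  shows "card (arith_prog m r k) = k"
  unfolding arith_prog_eq_image using assms by (subst card_image) (auto simp: inj_on_def)

lemma square_roots_bounds:
  assumes "finite X"
  shows finite_square_roots: "finite (square_roots X)"
    and card_square_roots_le: "card (square_roots X) \<le> card X"
proof -
  have inj: "inj_on (\<lambda>x. (int x)\<^sup>2) (square_roots X)"
    by (auto simp: inj_on_def)
  have sub: "(\<lambda>x. (int x)\<^sup>2) ` square_roots X \<subseteq> X"
    by (auto simp: square_roots_def)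
  show "finite (square_roots X)"
    using inj sub assms by (metis finite_imageD finite_subset)
  show "card (square_roots X) \<le> card X"
    using inj sub assms by (rule card_inj_on_le)
qed

section \<open>Counting pairs of squares in one progression\<close>

lemma card_square_le_card_pairs:
  fixes A :: "nat set"
  assumes "finite A"
  shows "card A * card A \<le> card A + 2 * card {(x, y). x \<in> A \<and> y \<in> A \<and> y < x}"
proof -
  define P where "P = {(x, y). x \<in> A \<and> y \<in> A \<and> y < x}"
  have "P \<subseteq> A \<times> A"
    by (auto simp: P_def)
  hence fin: "finite P"
    using assms by (metis finite_SigmaI finite_subset)
  \<comment> \<open>Diagonal, pairs below it, and their mirror images.\<close>
  have "A \<times> A \<subseteq> (\<lambda>x. (x, x)) ` A \<union> (P \<union> prod.swap ` P)"
  proof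
    fix p assume "p \<in> A \<times> A"
    then obtain x y where "p = (x, y)" "x \<in> A" "y \<in> A" by auto
    thus "p \<in> (\<lambda>x. (x, x)) ` A \<union> (P \<union> prod.swap ` P)"
      by (cases x y rule: linorder_cases) (auto simp: P_def image_iff)
  qed
  hence "card (A \<times> A) \<le> card ((\<lambda>x. (x, x)) ` A \<union> (P \<union> prod.swap ` P))"
    using fin assms by (intro card_mono) auto
  also have "\<dots> \<le> card ((\<lambda>x. (x, x)) ` A) + card (P \<union> prod.swap ` P)"
    by (rule card_Un_le)
  also have "\<dots> \<le> card A + (card P + card P)"
    using card_image_le[OF assms, of "\<lambda>x. (x, x)"] card_image_le[OF fin, of prod.swap]
      card_Un_le[of P "prod.swap ` P"]
    by linarith
  finally show ?thesis
    by (simp add: card_cartesian_product P_def)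
qed

lemma square_root_pair_decomposition:
  assumes m: "m > 0" and xy: "x \<in> square_roots (arith_prog m r k)"
    "y \<in> square_roots (arith_prog m r k)" "y < x"
  obtains d u v where "d dvd m" "(u, v) \<in> hyperbola_points k"
    "x - y = d * u" "x + y = (m div d) * v"
proof -
  obtain i where i: "(int x)\<^sup>2 = int m * int i + r" "i \<le> k"
    using xy by (auto simp: square_roots_def arith_prog_def)
  obtain j where j: "(int y)\<^sup>2 = int m * int j + r"
    using xy by (auto simp: square_roots_def arith_prog_def)
  have prod: "(x - y) * (x + y) = m * (i - j)"
  proof -
    have "(int y)\<^sup>2 < (int x)\<^sup>2"
      using xy by (intro power_strict_mono) auto
    hence "int m * int j < int m * int i"
      using i j by linarith
    hence "j < i"
      using m by simp
    \<comment> \<open>Natural subtraction truncates, so the identity is proved over the integers,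
      using \<open>y < x\<close> and \<open>j < i\<close>.\<close>
    have "int ((x - y) * (x + y)) = (int x - int y) * (int x + int y)"
      using of_nat_diff[OF less_imp_le[OF xy(3)], where ?'a = int] by simp
    also have "\<dots> = (int x)\<^sup>2 - (int y)\<^sup>2"
      by (simp add: power2_eq_square algebra_simps)
    also have "\<dots> = int (m * (i - j))"
      using i j \<open>j < i\<close> by (simp add: of_nat_diff algebra_simps)
    finally show ?thesis
      using of_nat_eq_iff by blast
  qed
  hence "m dvd (x - y) * (x + y)" by simp
  \<comment> \<open>A divisor of a product is a product of divisors of the two factors.\<close>
  then obtain d e where de: "m = d * e" "d dvd x - y" "e dvd x + y"
    using division_decomp by blast
  then obtain u v where uv: "x - y = d * u" "x + y = e * v"
    by (auto elim!: dvdE)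
  have "m * (u * v) = m * (i - j)"
    using prod uv de by (simp add: algebra_simps)
  hence "u * v = i - j"
    using m by simp
  \<comment> \<open>Both \<open>x - y\<close> and \<open>x + y\<close> are nonzero because
    \<open>y < x\<close>.\<close>
  moreover have "u \<ge> 1" "v \<ge> 1"
    using uv xy by (cases u; cases v; simp)+
  ultimately have "(u, v) \<in> hyperbola_points k"
    using i by (simp add: hyperbola_points_iff)
  moreover have "m div d = e"
    using de m by simp
  ultimately show thesis
    using that[of d u v] uv de by simp
qed

lemma card_square_root_pairs_le:
  fixes r :: int and k :: nat
  assumes "m > 0"
  defines "A \<equiv> square_roots (arith_prog m r k)"
  shows "card {(x, y). x \<in> A \<and> y \<in> A \<and> y < x} \<le> divisor_count m * card (hyperbola_points k)"
proof -
  \<comment> \<open>\<open>F\<close> recovers \<open>x\<close> and \<open>y\<close> as half the sum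
    and half the difference of \<open>x + y\<close> and \<open>x - y\<close>. Triples of wrong
    parity or with truncated subtraction give stray values, which is harmless: the image only has to
    cover the pairs.\<close>
  define F where "F = (\<lambda>(d, u, v). ((d * u + (m div d) * v) div 2, ((m div d) * v - d * u) div 2))"
  have fin: "finite ({d. d dvd m} \<times> hyperbola_points k)"
    using assms finite_hyperbola_points by simp
  have "{(x, y). x \<in> A \<and> y \<in> A \<and> y < x} \<subseteq> F ` ({d. d dvd m} \<times> hyperbola_points k)"
  proof clarify
    fix x y assume xy: "x \<in> A" "y \<in> A" "y < x"
    then obtain d u v where duv: "d dvd m" "(u, v) \<in> hyperbola_points k"
      "x - y = d * u" "x + y = (m div d) * v"
      using square_root_pair_decomposition[OF \<open>m > 0\<close>] unfolding A_def by metis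
    have "F (d, u, v) = ((x - y + (x + y)) div 2, (x + y - (x - y)) div 2)"
      by (simp add: F_def duv)
    also have "\<dots> = (x, y)"
      using xy by auto
    finally show "(x, y) \<in> F ` ({d. d dvd m} \<times> hyperbola_points k)"
      using duv by (intro image_eqI[of _ _ "(d, u, v)"]) auto
  qed
  hence "card {(x, y). x \<in> A \<and> y \<in> A \<and> y < x} \<le> card ({d. d dvd m} \<times> hyperbola_points k)"
    using fin by (rule surj_card_le[rotated])
  thus ?thesis
    by (simp add: card_cartesian_product divisor_count_def)
qed

lemma divisor_count_pos: "m > 0 \<Longrightarrow> divisor_count m \<ge> 1"
  unfolding divisor_count_def
  by (metis (mono_tags) One_nat_def Suc_leI card_gt_0_iff dvd_refl empty_iff finite_divisors_nat mem_Collect_eq)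

lemma card_square_roots_arith_prog_squared_le:
  assumes "m > 0" "k \<ge> 1"
  shows "(real (card (square_roots (arith_prog m r k))))\<^sup>2
           \<le> real (divisor_count m) * real k * (3 + 2 * ln (real k))"
proof -
  define A where "A = square_roots (arith_prog m r k)"
  define t where "t = real (divisor_count m)"
  have t: "t \<ge> 1"
    using divisor_count_pos[OF assms(1)] by (simp add: t_def)
  have fin: "finite A"
    unfolding A_def by (intro finite_square_roots finite_arith_prog)
  have "card A \<le> k"
    using card_square_roots_le[OF finite_arith_prog] card_arith_prog_le le_trans
    unfolding A_def by blast
  \<comment> \<open>This absorbs the diagonal term into \<open>t * k\<close>, whence the constant 3
    = 1 + 2.\<close>
  hence k: "real (card A) \<le> t * real k"
    using t mult_right_mono[of 1 t "real k"] by simp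
  have "card A * card A \<le> card A + 2 * (divisor_count m * card (hyperbola_points k))"
    using card_square_le_card_pairs[OF fin] card_square_root_pairs_le[OF assms(1), of r k]
    unfolding A_def by linarith
  hence "real (card A * card A) \<le> real (card A + 2 * (divisor_count m * card (hyperbola_points k)))"
    by (rule of_nat_mono)
  hence "(real (card A))\<^sup>2 \<le> real (card A) + 2 * (t * real (card (hyperbola_points k)))"
    by (simp add: power2_eq_square t_def)
  also have "\<dots> \<le> t * real k + 2 * (t * (real k * (1 + ln (real k))))"
    using k t card_hyperbola_points_le[OF assms(2)] by (intro add_mono mult_left_mono) auto
  also have "\<dots> = t * real k * (3 + 2 * ln (real k))"
    by (simp add: algebra_simps)
  finally show ?thesis
    by (simp add: A_def t_def)
qed

section \<open>Logarithm estimates and the small cases\<close>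

lemma ln_ge_of_power2_le:
  assumes "2 ^ a \<le> x"
  shows "ln x \<ge> real a * (2 / 3)"
proof -
  have "real a * (2 / 3) \<le> real a * ln 2"
    using ln2_ge_two_thirds by (intro mult_left_mono) auto
  also have "\<dots> = ln (2 ^ a)"
    by (simp add: ln_realpow)
  also have "\<dots> \<le> ln x"
    using assms by (intro ln_mono) auto
  finally show ?thesis .
qed

text \<open>Here \<open>s\<close> is the integer square root of \<open>N\<close>. Since
  \<open>N \<le> s * (s + 2)\<close>, it is enough that \<open>s + 2 \<le> 4 * ln N\<close>. This
  fails only for \<open>N = 2\<close>, where the claim is just
  \<open>2 \<le> 4 * ln 2\<close>.\<close>

lemma le_floor_sqrt_times_ln:
  fixes N s :: nat
  assumes "s\<^sup>2 \<le> N" "N < (s + 1)\<^sup>2" "2 \<le> N" "s \<le> 5"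
  shows "real N \<le> real s * (4 * ln (real N))"
proof -
  have up: "real N \<le> real s * real s + 2 * real s"
  proof -
    have "N \<le> s * s + 2 * s"
      using assms by (simp add: power2_eq_square)
    hence "real N \<le> real (s * s + 2 * s)" by (rule of_nat_mono)
    thus ?thesis by simp
  qed
  have "s \<noteq> 0"
    using assms by (cases s) auto
  then consider "s = 1" "N = 2" | "s = 1" "N = 3" | "s = 2" | "s \<ge> 3"
    using assms by (cases "s = 1"; cases "s = 2") (force simp: power2_eq_square)+
  hence "real s + 2 \<le> 4 * ln (real N) \<or> (s = 1 \<and> N = 2)"
  proof cases
    case 2
    \<comment> \<open>Comparison with a power of 2 gives only \<open>ln 3 \<ge> 2 / 3\<close>, short
      of the required \<open>3 / 4\<close>.\<close>
    have "exp 1 < (3 :: real)"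
      using e_less_272 by simp
    hence "1 < ln (3 :: real)"
      by (metis exp_less_cancel_iff exp_ln zero_less_numeral)
    thus ?thesis using 2 by simp
  next
    case 3
    hence "N \<ge> 4" using assms by simp
    thus ?thesis using 3 ln_ge_of_power2_le[of 2 "real N"] by simp
  next
    case 4
    \<comment> \<open>From \<open>N \<ge> 9 > 2 ^ 3\<close> follows \<open>4 * ln N \<ge> 8\<close>,
      while \<open>s + 2 \<le> 7\<close>.\<close>
    hence "3\<^sup>2 \<le> s\<^sup>2" by (intro power_mono) auto
    hence "N \<ge> 9" using assms by simp
    thus ?thesis using assms ln_ge_of_power2_le[of 3 "real N"] by simp
  qed auto
  thus ?thesis
  proof
    assume "real s + 2 \<le> 4 * ln (real N)"
    hence "real s * (real s + 2) \<le> real s * (4 * ln (real N))"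
      by (intro mult_left_mono) auto
    thus ?thesis using up by (simp add: algebra_simps)
  next
    assume "s = 1 \<and> N = 2"
    thus ?thesis using ln2_ge_two_thirds by simp
  qed
qed

section \<open>Summation over the progressions\<close>

theorem theorem1p2:
  fixes N T K :: nat and m k :: "nat \<Rightarrow> nat" and r :: "nat \<Rightarrow> int"
  assumes "N \<ge> 2" and "T \<ge> 1"
    and "\<And>i. i \<in> {1..T} \<Longrightarrow> m i > 0"
    and "\<And>i. i \<in> {1..T} \<Longrightarrow> k i \<ge> 1"
    and "\<And>i. i \<in> {1..T} \<Longrightarrow> arith_prog (m i) (r i) (k i) \<subseteq> {1..int N}"
    and "squares_upto N \<subseteq> (\<Union>i\<in>{1..T}. arith_prog (m i) (r i) (k i))"
    and "K = Max ((\<lambda>i. divisor_count (m i)) ` {1..T})"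
  shows "real T * (\<Sum>i=1..T. real (k i)) \<ge> real N / (4 * real K * ln (real N))"
proof -
  define s where "s = nat \<lfloor>sqrt (real N)\<rfloor>"
  define S where "S i = card (square_roots (arith_prog (m i) (r i) (k i)))" for i
  define L where "L = ln (real N)"
  define W where "W = (\<Sum>i=1..T. real (k i))"
  have L: "L > 0"
    using assms(1) by (simp add: L_def)
  have div_le_K: "divisor_count (m i) \<le> K" if "i \<in> {1..T}" for i
    unfolding assms(7) using that by (intro Max_ge) auto
  have K: "K \<ge> 1"
    using div_le_K[of 1] divisor_count_pos[of "m 1"] assms(2) assms(3)[of 1] by simp
  have s_eq: "\<lfloor>sqrt (real N)\<rfloor> = int s"
    by (simp add: s_def)
  have s_le: "s\<^sup>2 \<le> N"
  proof -
    have "real s \<le> sqrt (real N)"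
      using of_int_floor_le[of "sqrt (real N)"] by (simp add: s_eq)
    hence "(real s)\<^sup>2 \<le> (sqrt (real N))\<^sup>2"
      by (intro power_mono) auto
    hence "real (s\<^sup>2) \<le> real N"
      by simp
    thus ?thesis
      by (simp only: of_nat_le_iff)
  qed
  have N_less: "N < (s + 1)\<^sup>2"
  proof -
    have "sqrt (real N) < real s + 1"
      using floor_correct[of "sqrt (real N)"] by (simp add: s_eq)
    hence "(sqrt (real N))\<^sup>2 < (real s + 1)\<^sup>2"
      by (intro power_strict_mono) auto
    hence "real N < real ((s + 1)\<^sup>2)"
      by (simp add: add.commute)
    thus ?thesis
      by (simp only: of_nat_less_iff)
  qed
  have s_le_sum: "s \<le> (\<Sum>i=1..T. S i)"
  proof -
    \<comment> \<open>Each square up to \<open>N\<close> lies in some progression, so the root sets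
      cover \<open>{1..s}\<close> and the union bound applies.\<close>
    have "{1..s} \<subseteq> (\<Union>i\<in>{1..T}. square_roots (arith_prog (m i) (r i) (k i)))"
    proof
      fix x assume x: "x \<in> {1..s}"
      hence "(int x)\<^sup>2 \<in> squares_upto N"
        by (auto simp: squares_upto_def s_eq)
      thus "x \<in> (\<Union>i\<in>{1..T}. square_roots (arith_prog (m i) (r i) (k i)))"
        using assms(6) x by (auto simp: square_roots_def)
    qed
    hence "card {1..s} \<le> card (\<Union>i\<in>{1..T}. square_roots (arith_prog (m i) (r i) (k i)))"
      by (intro card_mono) (auto intro: finite_square_roots finite_arith_prog)
    also have "\<dots> \<le> (\<Sum>i=1..T. S i)"
      unfolding S_def by (intro card_UN_le) auto
    finally show ?thesis by simp
  qed
  have "real N \<le> real T * W * (4 * real K * L)"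
  proof (cases "s \<le> 5")
    case True
    have "S i \<le> k i" for i
      using card_square_roots_le[OF finite_arith_prog] card_arith_prog_le le_trans
      unfolding S_def by blast
    hence "(\<Sum>i=1..T. S i) \<le> (\<Sum>i=1..T. k i)"
      by (intro sum_mono)
    hence "s \<le> (\<Sum>i=1..T. k i)"
      using s_le_sum by linarith
    hence "real s \<le> real (\<Sum>i=1..T. k i)"
      by (rule of_nat_mono)
    hence "real s \<le> W"
      by (simp add: W_def)
    also have "W \<le> real T * W"
      using assms(2) mult_right_mono[of 1 "real T" W] by (simp add: W_def sum_nonneg)
    finally have "real s \<le> real T * W" .
    moreover have "4 * L \<le> 4 * real K * L"
      using K L by simp
    ultimately have "real s * (4 * L) \<le> real T * W * (4 * real K * L)"
      using L by (intro mult_mono) auto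
    thus ?thesis
      using le_floor_sqrt_times_ln[OF s_le N_less assms(1) True] by (simp add: L_def)
  next
    case False
    have "6\<^sup>2 \<le> s\<^sup>2"
      using False by (intro power_mono) auto
    hence "N \<ge> 36" using s_le by simp
    \<comment> \<open>As \<open>36 \<ge> 2 ^ 5\<close>, \<open>L \<ge> 10 / 3\<close>. The bound 3
      lets \<open>3 + 2 * ln (k i)\<close> be replaced by \<open>3 * L\<close>.\<close>
    hence L3: "L \<ge> 3"
      using ln_ge_of_power2_le[of 5 "real N"] by (simp add: L_def)
    have S_le: "real (S i) \<le> sqrt (3 * real K * L) * sqrt (real (k i))" if i: "i \<in> {1..T}" for i
    proof -
      \<comment> \<open>A positive difference makes the \<open>k i\<close> terms distinct elements
        of \<open>{1..N}\<close>.\<close>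
      have "k i \<le> N"
        using card_mono[OF _ assms(5)[OF i]] card_arith_prog[OF assms(3)[OF i]] by simp
      hence "ln (real (k i)) \<le> L"
        using assms(4)[OF i] unfolding L_def by (intro ln_mono) auto
      hence ln_le: "3 + 2 * ln (real (k i)) \<le> 3 * L"
        using L3 by linarith
      have "(real (S i))\<^sup>2 \<le> real (divisor_count (m i)) * real (k i) * (3 + 2 * ln (real (k i)))"
        unfolding S_def
        by (rule card_square_roots_arith_prog_squared_le[OF assms(3)[OF i] assms(4)[OF i]])
      also have "\<dots> \<le> real K * real (k i) * (3 * L)"
        using div_le_K[OF i] ln_le assms(4)[OF i] by (intro mult_mono) auto
      finally have "real (S i) \<le> sqrt (3 * real K * L * real (k i))"
        by (intro real_le_rsqrt) (simp add: algebra_simps)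
      thus ?thesis
        by (simp add: real_sqrt_mult)
    qed
    have "real s \<le> real (\<Sum>i=1..T. S i)"
      using s_le_sum by (rule of_nat_mono)
    also have "\<dots> \<le> (\<Sum>i=1..T. sqrt (3 * real K * L) * sqrt (real (k i)))"
      unfolding of_nat_sum by (intro sum_mono S_le)
    also have "\<dots> = sqrt (3 * real K * L) * (\<Sum>i=1..T. sqrt (real (k i)))"
      by (simp add: sum_distrib_left)
    finally have "(real s)\<^sup>2 \<le> (sqrt (3 * real K * L) * (\<Sum>i=1..T. sqrt (real (k i))))\<^sup>2"
      by (intro power_mono) auto
    \<comment> \<open>The factor 1 prepares Cauchy-Schwarz against the constant vector, whose
      squared norm is \<open>T\<close>.\<close>
    also have "\<dots> = 3 * real K * L * (\<Sum>i=1..T. 1 * sqrt (real (k i)))\<^sup>2"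
      using L by (simp add: power_mult_distrib)
    also have "\<dots> \<le> 3 * real K * L * ((\<Sum>i=1..T. 1\<^sup>2) * (\<Sum>i=1..T. (sqrt (real (k i)))\<^sup>2))"
      using L by (intro mult_left_mono Cauchy_Schwarz_ineq_sum) auto
    also have "\<dots> = 3 * real K * L * (real T * W)"
      by (simp add: W_def)
    finally have s2: "(real s)\<^sup>2 \<le> 3 * real K * L * (real T * W)" .
    \<comment> \<open>For \<open>s \<ge> 6\<close>, \<open>2 * s\<close> is at most a third of
      \<open>s * s\<close>. The resulting factor \<open>4 / 3\<close> turns the 3 of
      \<open>s2\<close> into the final 4.\<close>
    have "3 * N \<le> 4 * s\<^sup>2"
    proof -
      have "6 * s \<le> s * s" using False by (intro mult_right_mono) auto
      moreover have "N \<le> s * s + 2 * s" using N_less by (simp add: power2_eq_square)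
      ultimately show ?thesis unfolding power2_eq_square by linarith
    qed
    hence "real (3 * N) \<le> real (4 * s\<^sup>2)" by (rule of_nat_mono)
    hence "real N \<le> 4 / 3 * (real s)\<^sup>2" by simp
    thus ?thesis using s2 by (simp add: algebra_simps)
  qed
  thus ?thesis
    using K L by (simp add: W_def L_def divide_le_eq)
qed

end
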